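(* Let $\{(W_j,P_{W_j})\}_{j\in J}$ be an $f$-basis system for $\mathcal{H}$, and suppose that $\{V_j\}_{j\in J}$ is a family of closed subspaces of $\mathcal{H}$. If $\{Q_{V_j}\}_{j\in J}$ is an $f$-biorthogonal sequence of $\{V_j\}_{j\in J}$ such that $$\Big\|\sum_{j\in F}(P_{W_j}f-Q_{V_j}f)\Big\|\leq\lambda\Big\|\sum_{j\in F}P_{W_j}f\Big\|\qquad\forall f\in\mathcal{H}$$ for some constant $\lambda$ with $0\leq\lambda<1$ and any finite subset $F\subset J$, then $\{V_j\}_{j\in J}$ is an $f$-basis for $\mathcal{H}$.
   Context: $\mathcal{H}$ is a separable Hilbert space and $J$ is a countable (or finite) index set. A sequence $\{W_j\}_{j\in J}$ of closed subspaces of $\mathcal{H}$ is an $f$-basis (fusion Schauder basis) for $\mathcal{H}$ if for every $f\in\mathcal{H}$ there exists a unique sequence $\{g_j\}_{j\in J}$ with $g_j\in W_j$ such that $f=\sum_{j\in J}g_j$, with convergence in norm. In that case $P_{W_j}:\mathcal{H}\to W_j$, $P_{W_j}f=g_j$; $\{P_{W_j}\}_{j\in J}$ is called the $f$-dual sequence of $\{W_j\}_{j\in J}$, and $\{(W_j,P_{W_j})\}_{j\in J}$ is called an $f$-basis system. For a sequence $\{V_j\}_{j\in J}$ of closed subspaces, a family of bounded operators $\{Q_j\in B(\mathcal{H},V_j) : j\in J\}$ is an $f$-biorthogonal sequence of $\{V_j\}_{j\in J}$ if $Q_ig_j=\delta_{ij}g_j$ for all $i,j\in J$ and $g_j\in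 V_j$. *)

theory Defs
  imports "HOL-Analysis.Analysis"
begin

text \<open>
  Real and complex Hilbert spaces are treated at once. The space is a type of sort
  \<open>{real_inner, complete_space}\<close>, and \<open>smul\<close> is its multiplication by scalars from \<open>'k\<close>.
  For \<open>'k = real\<close> the axioms force \<open>smul = scaleR\<close>. For \<open>'k = complex\<close> they describe exactly
  the complex Hilbert spaces: the class operation \<open>inner\<close> is then the real part of the complex
  inner product, which is recovered from the norm by polarization.
\<close>

locale hilbert_scalars = vector_space smul
  for smul :: "'k::real_normed_field \<Rightarrow> 'a::{real_inner,complete_space} \<Rightarrow> 'a" +
  assumes smul_of_real: "smul (of_real r) x = r *\<^sub>R x"
    and norm_smul: "norm (smul c x) = norm c * norm x"

lemma hilbert_scalars_scaleR:
  "hilbert_scalars (scaleR :: real \<Rightarrow> 'a::{real_inner,complete_space} \<Rightarrow> 'a)"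
  by unfold_locales (auto simp: algebra_simps)

lemma hilbert_scalars_complex:
  "hilbert_scalars ((*) :: complex \<Rightarrow> complex \<Rightarrow> complex)"
  by unfold_locales (auto simp: algebra_simps norm_mult scaleR_conv_of_real)

definition closed_subspace :: "('k::real_normed_field \<Rightarrow> 'a::real_normed_vector \<Rightarrow> 'a) \<Rightarrow> 'a set \<Rightarrow> bool"
  where "closed_subspace smul V \<longleftrightarrow> module.subspace smul V \<and> closed V"

definition bounded_operator_into ::
    "('k::real_normed_field \<Rightarrow> 'a::real_normed_vector \<Rightarrow> 'a) \<Rightarrow> 'a set \<Rightarrow> ('a \<Rightarrow> 'a) \<Rightarrow> bool"
  where "bounded_operator_into smul V Q \<longleftrightarrow>
    Vector_Spaces.linear smul smul Q \<and> (\<exists>K. \<forall>x. norm (Q x) \<le> K * norm x) \<and> range Q \<subseteq> V"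

text \<open>
  Schauder-type expansions converge along a fixed ordering of the index set \<open>J\<close>. The ordering is
  given by a numbering \<open>e\<close>, assumed injective on \<open>J\<close> where it is used, so that \<open>J\<close> is finite or
  countably infinite; its values may have gaps, which only repeat partial sums. For a set \<open>J\<close> of
  natural numbers in its usual order, \<open>e\<close> is the identity.
\<close>

definition ordered_sums :: "'i set \<Rightarrow> ('i \<Rightarrow> nat) \<Rightarrow> ('i \<Rightarrow> 'a::real_normed_vector) \<Rightarrow> 'a \<Rightarrow> bool"
  where "ordered_sums J e g f \<longleftrightarrow> (\<lambda>n. \<Sum>j | j \<in> J \<and> e j < n. g j) \<longlonglongrightarrow> f"

text \<open>Extensional functions \<open>\<Pi>\<^sub>E\<close> represent families indexed by \<open>J\<close>, so that uniqueness concerns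
  only the values on \<open>J\<close>.\<close>

definition f_expansion ::
    "'i set \<Rightarrow> ('i \<Rightarrow> nat) \<Rightarrow> ('i \<Rightarrow> 'a::real_normed_vector set) \<Rightarrow> 'a \<Rightarrow> ('i \<Rightarrow> 'a) \<Rightarrow> bool"
  where "f_expansion J e W f g \<longleftrightarrow> g \<in> (\<Pi>\<^sub>E j\<in>J. W j) \<and> ordered_sums J e g f"

definition f_basis ::
    "('k::real_normed_field \<Rightarrow> 'a::real_normed_vector \<Rightarrow> 'a) \<Rightarrow> 'i set \<Rightarrow> ('i \<Rightarrow> nat) \<Rightarrow> ('i \<Rightarrow> 'a set) \<Rightarrow> bool"
  where "f_basis smul J e W \<longleftrightarrow>
    (\<forall>j\<in>J. closed_subspace smul (W j)) \<and> (\<forall>f. \<exists>!g. f_expansion J e W f g)"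

definition f_dual ::
    "'i set \<Rightarrow> ('i \<Rightarrow> nat) \<Rightarrow> ('i \<Rightarrow> 'a::real_normed_vector set) \<Rightarrow> 'i \<Rightarrow> 'a \<Rightarrow> 'a"
  where "f_dual J e W j f = (THE g. f_expansion J e W f g) j"

definition f_basis_system ::
    "('k::real_normed_field \<Rightarrow> 'a::real_normed_vector \<Rightarrow> 'a) \<Rightarrow> 'i set \<Rightarrow> ('i \<Rightarrow> nat) \<Rightarrow>
      ('i \<Rightarrow> 'a set) \<Rightarrow> ('i \<Rightarrow> 'a \<Rightarrow> 'a) \<Rightarrow> bool"
  where "f_basis_system smul J e W P \<longleftrightarrow> f_basis smul J e W \<and> (\<forall>j\<in>J. P j = f_dual J e W j)"

definition f_biorthogonal ::
    "('k::real_normed_field \<Rightarrow> 'a::real_normed_vector \<Rightarrow> 'a) \<Rightarrow> 'i set \<Rightarrow>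
      ('i \<Rightarrow> 'a set) \<Rightarrow> ('i \<Rightarrow> 'a \<Rightarrow> 'a) \<Rightarrow> bool"
  where "f_biorthogonal smul J V Q \<longleftrightarrow>
    (\<forall>j\<in>J. bounded_operator_into smul (V j) (Q j)) \<and>
    (\<forall>i\<in>J. \<forall>j\<in>J. \<forall>g\<in>V j. Q i g = (if i = j then g else 0))"

end

theory Submission
  imports Defs
begin

text \<open>
  The hypothesis, applied to blocks of consecutive indices, makes the partial sums of
  \<open>\<Sum>j. Q j f\<close> Cauchy, because those of \<open>\<Sum>j. P j f\<close> are. The limit \<open>T f\<close> is additive in \<open>f\<close>
  and satisfies \<open>norm (f - T f) \<le> lam * norm f\<close>, so \<open>T\<close> is onto by the contraction principle;
  an expansion of \<open>T h\<close> is \<open>\<Sum>j. Q j h\<close>. Conversely the continuous maps \<open>Q i\<close> read off the terms of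
  any expansion, which is therefore unique.
\<close>

text \<open>The solutions of \<open>T x = y\<close> are the fixed points of
  \<open>y + (x - T x)\<close>, a map that contracts with factor \<open>c\<close> because
  \<open>T\<close> respects differences.\<close>

lemma surj_of_near_identity:
  fixes T :: "'a::{real_normed_vector,complete_space} \<Rightarrow> 'a"
  assumes diff: "\<And>x y. T (x - y) = T x - T y"
    and near: "\<And>x. norm (x - T x) \<le> c * norm x"
    and c: "0 \<le> c" "c < 1"
  shows "surj T"
  unfolding surj_def
proof
  fix y
  let ?g = "\<lambda>x. y + (x - T x)"
  have "dist (?g u) (?g v) \<le> c * dist u v" for u v
    using near[of "u - v"] by (simp add: dist_norm diff algebra_simps)
  then obtain x where "?g x = x"
    using banach_fix_type[OF c, of ?g] by blast
  then show "\<exists>x. y = T x"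
    by (auto simp: algebra_simps)
qed

text \<open>Restricting the scalars to the reals makes the continuity facts for
  \<open>bounded_linear\<close> applicable.\<close>

lemma (in hilbert_scalars) bounded_linear_of_bounded_operator_into:
  assumes "bounded_operator_into smul V Q"
  shows "bounded_linear Q"
proof -
  obtain K where lin: "Vector_Spaces.linear smul smul Q"
    and K: "\<And>x. norm (Q x) \<le> K * norm x"
    using assms unfolding bounded_operator_into_def by blast
  interpret Q: Vector_Spaces.linear smul smul Q by (rule lin)
  show ?thesis
  proof (rule bounded_linear_intro)
    show "Q (r *\<^sub>R x) = r *\<^sub>R Q x" for r x
      using Q.scale[of "of_real r" x] by (simp add: smul_of_real)
    show "norm (Q x) \<le> norm x * K" for x
      using K[of x] by (simp add: mult.commute)
  qed (rule Q.add)
qed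

text \<open>This makes the partial sums genuine sums, not the default value 0 of \<open>sum\<close>
  over an infinite set.\<close>

lemma finite_initial_segment: "inj_on e J \<Longrightarrow> finite {j \<in> J. e j < (n::nat)}"
  using finite_vimage_IntI[of "{..<n}" e J] by (simp add: vimage_def Int_def conj_commute)

text \<open>By continuity \<open>T f\<close> is the limit of the images of the partial sums, and
  these equal \<open>g i\<close> as soon as the segment contains \<open>i\<close>.\<close>

lemma ordered_sums_apply_biorthogonal:
  assumes inj: "inj_on e J" and T: "bounded_linear T" and i: "i \<in> J"
    and bi: "\<And>j. j \<in> J \<Longrightarrow> T (g j) = (if i = j then g j else 0)"
    and sums: "ordered_sums J e g f"
  shows "T f = g i"
proof -
  let ?A = "\<lambda>n. {j \<in> J. e j < n}"
  have "(\<lambda>n. T (\<Sum>j\<in>?A n. g j)) \<longlonglongrightarrow> T f"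
    using bounded_linear.tendsto[OF T] sums unfolding ordered_sums_def by blast
  moreover have "T (\<Sum>j\<in>?A n. g j) = g i" if "e i < n" for n
  proof -
    have "T (\<Sum>j\<in>?A n. g j) = (\<Sum>j\<in>?A n. T (g j))"
      by (rule linear_sum[OF bounded_linear.linear[OF T]])
    also have "\<dots> = (\<Sum>j\<in>?A n. if i = j then g j else 0)"
      using bi by (intro sum.cong) auto
    also have "\<dots> = g i"
      using finite_initial_segment[OF inj] i that by (simp add: sum.delta)
    finally show ?thesis .
  qed
  then have "\<forall>\<^sub>F n in sequentially. T (\<Sum>j\<in>?A n. g j) = g i"
    using eventually_gt_at_top[of "e i"] by (rule eventually_mono[rotated])
  then have "(\<lambda>n. T (\<Sum>j\<in>?A n. g j)) \<longlonglongrightarrow> g i"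
    by (rule tendsto_eventually)
  ultimately show ?thesis
    by (rule LIMSEQ_unique)
qed

text \<open>The description \<open>THE\<close> in \<open>f_dual\<close> denotes an actual expansion
  because exactly one exists.\<close>

lemma f_basis_system_ordered_sums:
  assumes "f_basis_system smul J e W P"
  shows "ordered_sums J e (\<lambda>j. P j f) f"
proof -
  define g where "g = (THE g. f_expansion J e W f g)"
  have unique: "\<exists>!g. f_expansion J e W f g"
    and P: "\<And>j. j \<in> J \<Longrightarrow> P j = f_dual J e W j"
    using assms unfolding f_basis_system_def f_basis_def by auto
  have "f_expansion J e W f g"
    unfolding g_def by (rule theI'[OF unique])
  moreover have "(\<Sum>j | j \<in> J \<and> e j < n. g j) = (\<Sum>j | j \<in> J \<and> e j < n. P j f)" for n
    using P by (intro sum.cong) (auto simp: f_dual_def g_def)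
  ultimately show ?thesis
    by (simp add: f_expansion_def ordered_sums_def)
qed

text \<open>Two partial sums differ by the sum over a finite block of indices, so the domination
  carries the Cauchy property from \<open>g\<close> to \<open>h\<close>.\<close>

lemma ordered_sums_convergent_of_dominated:
  fixes g h :: "'i \<Rightarrow> 'a::{real_normed_vector,complete_space}"
  assumes inj: "inj_on e J" and g: "ordered_sums J e g f"
    and dom: "\<And>F. finite F \<Longrightarrow> F \<subseteq> J \<Longrightarrow> norm (\<Sum>j\<in>F. h j) \<le> C * norm (\<Sum>j\<in>F. g j)"
  obtains l where "ordered_sums J e h l"
proof -
  let ?A = "\<lambda>n. {j \<in> J. e j < n}"
  have block: "(\<Sum>j\<in>?A n. u j) - (\<Sum>j\<in>?A m. u j) = (\<Sum>j\<in>?A n - ?A m. u j)"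
    if "m \<le> n" for m n and u :: "'i \<Rightarrow> 'a"
    using that finite_initial_segment[OF inj] by (subst sum_diff) auto
  \<comment> \<open>The claim is symmetric in \<open>m\<close> and \<open>n\<close>, so
    \<open>m \<le> n\<close> may be assumed and \<open>block\<close> applies.\<close>
  have le: "dist (\<Sum>j\<in>?A m. h j) (\<Sum>j\<in>?A n. h j) \<le> C * dist (\<Sum>j\<in>?A m. g j) (\<Sum>j\<in>?A n. g j)" for m n
  proof (induction m n rule: linorder_wlog)
    case (le m n)
    then show ?case
      using dom[of "?A n - ?A m"] finite_initial_segment[OF inj]
      by (subst (1 2) dist_commute) (auto simp: dist_norm block)
  next
    case (sym m n)
    then show ?case by (simp add: dist_commute)
  qed
  \<comment> \<open>The sign of \<open>C\<close> is unknown; \<open>max C 1\<close> is positive, so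
    the Cauchy tolerance can be divided by it.\<close>
  have le': "dist (\<Sum>j\<in>?A m. h j) (\<Sum>j\<in>?A n. h j)
      \<le> max C 1 * dist (\<Sum>j\<in>?A m. g j) (\<Sum>j\<in>?A n. g j)" for m n
    using le[of m n] by (rule order_trans) (intro mult_right_mono; simp)
  have "Cauchy (\<lambda>n. \<Sum>j\<in>?A n. g j)"
    using g unfolding ordered_sums_def by (rule LIMSEQ_imp_Cauchy)
  have "Cauchy (\<lambda>n. \<Sum>j\<in>?A n. h j)"
  proof (rule metric_CauchyI)
    fix r :: real assume "0 < r"
    have pos: "0 < max C 1" by simp
    with \<open>0 < r\<close> have "0 < r / max C 1" by (rule divide_pos_pos)
    then obtain M where M: "\<And>m n. m \<ge> M \<Longrightarrow> n \<ge> M \<Longrightarrow>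
        dist (\<Sum>j\<in>?A m. g j) (\<Sum>j\<in>?A n. g j) < r / max C 1"
      using metric_CauchyD[OF \<open>Cauchy (\<lambda>n. \<Sum>j\<in>?A n. g j)\<close>] by blast
    have "dist (\<Sum>j\<in>?A m. h j) (\<Sum>j\<in>?A n. h j) < r" if "m \<ge> M" "n \<ge> M" for m n
      using le'[of m n] M[OF that] by (simp only: pos_less_divide_eq[OF pos] mult.commute)
    then show "\<exists>M. \<forall>m\<ge>M. \<forall>n\<ge>M. dist (\<Sum>j\<in>?A m. h j) (\<Sum>j\<in>?A n. h j) < r"
      by blast
  qed
  then obtain l where "(\<lambda>n. \<Sum>j\<in>?A n. h j) \<longlonglongrightarrow> l"
    unfolding Cauchy_convergent_iff convergent_def by blast
  then show thesis
    using that by (simp add: ordered_sums_def)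
qed

theorem theorem4p3:
  fixes smul :: "'k::real_normed_field \<Rightarrow> 'a::{real_inner,complete_space} \<Rightarrow> 'a"
    and J :: "'i set" and e :: "'i \<Rightarrow> nat"
    and W V :: "'i \<Rightarrow> 'a set" and P Q :: "'i \<Rightarrow> 'a \<Rightarrow> 'a"
    and lam :: real
  assumes "hilbert_scalars smul"
    and "separable_space (euclidean :: 'a topology)"
    and "inj_on e J"
    and "f_basis_system smul J e W P"
    and "\<And>j. j \<in> J \<Longrightarrow> closed_subspace smul (V j)"
    and "f_biorthogonal smul J V Q"
    and "0 \<le> lam" and "lam < 1"
    and "\<And>F f. finite F \<Longrightarrow> F \<subseteq> J \<Longrightarrow>
           norm (\<Sum>j\<in>F. P j f - Q j f) \<le> lam * norm (\<Sum>j\<in>F. P j f)"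
  shows "f_basis smul J e V"
proof -
  interpret hilbert_scalars smul by (rule assms(1))
  note inj = \<open>inj_on e J\<close>
  have Q_into: "bounded_operator_into smul (V j) (Q j)" if "j \<in> J" for j
    using assms(6) that by (auto simp: f_biorthogonal_def)
  then have Q_bl: "bounded_linear (Q j)" if "j \<in> J" for j
    using that bounded_linear_of_bounded_operator_into by blast
  have Q_in: "Q j f \<in> V j" if "j \<in> J" for j f
    using Q_into[OF that] by (auto simp: bounded_operator_into_def)
  have bi: "Q i g = (if i = j then g else 0)" if "i \<in> J" "j \<in> J" "g \<in> V j" for i j g
    using assms(6) that by (simp add: f_biorthogonal_def)
  have P_sums: "ordered_sums J e (\<lambda>j. P j f) f" for f
    by (rule f_basis_system_ordered_sums[OF assms(4)])
  \<comment> \<open>Triangle inequality: the sum of the \<open>Q j f\<close> is that of the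
    \<open>P j f\<close> minus that of the differences, which costs the factor
    \<open>lam\<close>.\<close>
  have dom: "norm (\<Sum>j\<in>F. Q j f) \<le> (1 + lam) * norm (\<Sum>j\<in>F. P j f)"
    if "finite F" "F \<subseteq> J" for F f
    using assms(9)[OF that, of f] norm_triangle_sub[of "\<Sum>j\<in>F. Q j f" "\<Sum>j\<in>F. P j f"]
    by (simp add: sum_subtractf norm_minus_commute algebra_simps)
  have "\<exists>l. ordered_sums J e (\<lambda>j. Q j f) l" for f
    using ordered_sums_convergent_of_dominated[OF inj P_sums dom] by blast
  then obtain T where T: "\<And>f. ordered_sums J e (\<lambda>j. Q j f) (T f)"
    by metis
  have "surj T"
  proof (rule surj_of_near_identity[OF _ _ \<open>0 \<le> lam\<close> \<open>lam < 1\<close>])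
    fix x y
    have "(\<Sum>j | j \<in> J \<and> e j < n. Q j (x - y))
        = (\<Sum>j | j \<in> J \<and> e j < n. Q j x) - (\<Sum>j | j \<in> J \<and> e j < n. Q j y)" for n
      using linear_diff[OF bounded_linear.linear[OF Q_bl]]
      by (simp flip: sum_subtractf)
    then have "ordered_sums J e (\<lambda>j. Q j (x - y)) (T x - T y)"
      using tendsto_diff[OF T[of x, unfolded ordered_sums_def] T[of y, unfolded ordered_sums_def]]
      by (simp add: ordered_sums_def)
    then show "T (x - y) = T x - T y"
      using T[of "x - y"] LIMSEQ_unique unfolding ordered_sums_def by blast
  next
    fix x
    let ?S = "\<lambda>(R :: 'i \<Rightarrow> 'a \<Rightarrow> 'a) n. \<Sum>j | j \<in> J \<and> e j < n. R j x"
    have lims: "?S P \<longlonglongrightarrow> x" "?S Q \<longlonglongrightarrow> T x"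
      using P_sums T by (simp_all add: ordered_sums_def)
    \<comment> \<open>Take \<open>F\<close> to be an initial segment in the hypothesis and let
      \<open>n\<close> tend to infinity.\<close>
    show "norm (x - T x) \<le> lam * norm x"
    proof (rule LIMSEQ_le)
      show "(\<lambda>n. norm (?S P n - ?S Q n)) \<longlonglongrightarrow> norm (x - T x)"
        by (intro tendsto_intros lims)
      show "(\<lambda>n. lam * norm (?S P n)) \<longlonglongrightarrow> lam * norm x"
        by (intro tendsto_intros lims)
      show "\<exists>N. \<forall>n\<ge>N. norm (?S P n - ?S Q n) \<le> lam * norm (?S P n)"
        using assms(9)[of "{j \<in> J. e j < n}" x for n] finite_initial_segment[OF inj]
        by (auto simp flip: sum_subtractf)
    qed
  qed
  have "\<exists>!g. f_expansion J e V f g" for f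
  proof -
    \<comment> \<open>Existence: the partial sums of \<open>Q j h\<close> converge to
      \<open>T h\<close>, and each term lies in \<open>V j\<close>.\<close>
    obtain h where h: "f = T h"
      using \<open>surj T\<close> by (metis surjD)
    have "(\<Sum>j | j \<in> J \<and> e j < n. restrict (\<lambda>j. Q j h) J j) = (\<Sum>j | j \<in> J \<and> e j < n. Q j h)" for n
      by (intro sum.cong) auto
    then have ex: "f_expansion J e V f (\<lambda>j\<in>J. Q j h)"
      using T[of h] h Q_in by (auto simp: f_expansion_def ordered_sums_def)
    \<comment> \<open>Uniqueness: on \<open>J\<close> biorthogonality forces the values
      \<open>Q j f\<close>, which depend on \<open>f\<close> alone; off \<open>J\<close> both sides
      are \<open>undefined\<close> by extensionality.\<close>
    have coeff: "g = (\<lambda>j\<in>J. Q j f)" if "f_expansion J e V f g" for g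
    proof
      fix i
      show "g i = (\<lambda>j\<in>J. Q j f) i"
      proof (cases "i \<in> J")
        case True
        have "Q i (g j) = (if i = j then g j else 0)" if "j \<in> J" for j
          using bi[OF True that] \<open>f_expansion J e V f g\<close> that
          by (auto simp: f_expansion_def dest: PiE_mem)
        moreover have "ordered_sums J e g f"
          using that by (simp add: f_expansion_def)
        ultimately have "Q i f = g i"
          by (rule ordered_sums_apply_biorthogonal[OF inj Q_bl[OF True] True])
        then show ?thesis
          using True by simp
      qed (use that in \<open>auto simp: f_expansion_def\<close>)
    qed
    show ?thesis
      using ex coeff by metis
  qed
  then show ?thesis
    using assms(5) by (simp add: f_basis_def)
qed

end
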